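(* Let $r$ be a positive integer. The polynomials \[ F_r(x,y) = \frac{rx(x-1)}{2} + x + y \qquad\text{and}\qquad G_r(x,y) = \frac{rx(x+1)}{2} + x - y \] are packing polynomials on the integer sector $I(r) = \{(x,y)\in \mathbf{N}_0^2 : 0 \leq y \leq rx\}$; that is, each of them restricts to a bijection from $I(r)$ onto $\mathbf{N}_0$.
   Context: $\mathbf{N}_0$ denotes the set of nonnegative integers. A packing polynomial on an integer sector $I \subseteq \mathbf{N}_0^2$ is a polynomial in two variables (with real coefficients) whose restriction to $I$ is a one-to-one correspondence between $I$ and $\mathbf{N}_0$. *)

theory Defs
  imports "HOL-Analysis.Analysis"
begin

text \<open>
  Points of \<^term>\<open>I\<close> are pairs of naturals, embedded into the real plane before \<^term>\<open>p\<close> is evaluated;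
  \<^term>\<open>\<nat> :: real set\<close> is the set of nonnegative integers as real numbers.
  Polynomials are identified with the functions they induce, which loses nothing over the reals.
\<close>
definition packing_polynomial :: "(nat \<times> nat) set \<Rightarrow> (real \<times> real \<Rightarrow> real) \<Rightarrow> bool" where
  "packing_polynomial I p \<longleftrightarrow>
     real_polynomial_function p \<and> bij_betw (\<lambda>(x, y). p (real x, real y)) I \<nat>"

definition sector :: "nat \<Rightarrow> (nat \<times> nat) set" where
  "sector r = {(x, y). 0 \<le> y \<and> y \<le> r * x}"

definition F :: "nat \<Rightarrow> real \<times> real \<Rightarrow> real" where
  "F r = (\<lambda>(x, y). real r * x * (x - 1) / 2 + x + y)"

definition G :: "nat \<Rightarrow> real \<times> real \<Rightarrow> real" where
  "G r = (\<lambda>(x, y). real r * x * (x + 1) / 2 + x - y)"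

end

theory Submission imports Defs begin

text \<open>
  The column of the sector above \<open>x\<close> has \<open>r * x + 1\<close> points. \<open>F\<close> enumerates the sector column by
  column, each column upwards, so that the column above \<open>x\<close> is mapped onto the block of integers
  between two consecutive values of \<open>column_start\<close>. \<open>G\<close> enumerates each column downwards, that is,
  \<open>G\<close> is \<open>F\<close> composed with the involution \<open>(x, y) \<mapsto> (x, r * x - y)\<close> of the sector.
\<close>

definition column_start :: "nat \<Rightarrow> nat \<Rightarrow> nat" where
  "column_start r x = (\<Sum>i<x. r * i + 1)"

lemma column_start_0 [simp]: "column_start r 0 = 0"
  by (simp add: column_start_def)

lemma column_start_Suc [simp]: "column_start r (Suc x) = column_start r x + r * x + 1"
  by (simp add: column_start_def)

lemma mono_column_start: "mono (column_start r)"
  by (simp add: mono_iff_le_Suc)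

text \<open>The number of sector points left of column \<open>x\<close> is the value of
  \<open>F r\<close> at \<open>(x, 0)\<close>. Over the reals, neither \<open>real x - 1\<close> at
  \<open>x = 0\<close> nor the halving is truncated.\<close>

lemma real_column_start: "real (column_start r x) = real r * real x * (real x - 1) / 2 + real x"
  by (induction x) (auto simp: field_simps)

text \<open>Since \<open>y\<close> is at most \<open>r * x\<close>, the left side stays below the
  start of column \<open>Suc x\<close>, and starts are monotone. Used in both directions, this
  separates the columns for injectivity.\<close>

lemma column_less:
  assumes "x < x'" and "y \<le> r * x"
  shows "column_start r x + y < column_start r x' + y'"
proof -
  have "column_start r x + y < column_start r (Suc x)"
    using assms(2) by simp
  also have "\<dots> \<le> column_start r x'"
    using assms(1) by (intro monoD[OF mono_column_start]) simp
  finally show ?thesis by simp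
qed

lemma bij_betw_column_enumeration:
  "bij_betw (\<lambda>(x, y). column_start r x + y) (sector r) UNIV"
proof (rule bij_betw_imageI)
  show "inj_on (\<lambda>(x, y). column_start r x + y) (sector r)"
  proof (rule inj_onI, clarify)
    fix x y x' y'
    assume "(x, y) \<in> sector r" "(x', y') \<in> sector r"
      and eq: "column_start r x + y = column_start r x' + y'"
    then have "y \<le> r * x" "y' \<le> r * x'"
      by (auto simp: sector_def)
    with eq column_less[of x x' y r y'] column_less[of x' x y' r y] have "x = x'"
      by (metis less_irrefl linorder_neqE_nat)
    with eq show "x = x' \<and> y = y'" by simp
  qed
  \<comment> \<open>Surjectivity follows by walking through the sector: the successor value is
    attained one point higher, or, from the top of a column, at the bottom of the next.\<close>
  have "\<exists>x y. y \<le> r * x \<and> n = column_start r x + y" for n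
  proof (induction n)
    case 0
    show ?case by (intro exI[of _ 0]) simp
  next
    case (Suc n)
    then obtain x y where xy: "y \<le> r * x" "n = column_start r x + y" by blast
    show ?case
    proof (cases "y < r * x")
      case True
      with xy show ?thesis by (intro exI[of _ x] exI[of _ "Suc y"]) simp
    next
      case False
      with xy show ?thesis by (intro exI[of _ "Suc x"] exI[of _ 0]) simp
    qed
  qed
  then show "(\<lambda>(x, y). column_start r x + y) ` sector r = UNIV"
    by (force simp: sector_def image_iff)
qed

text \<open>On the sector the subtraction in \<open>nat\<close> is never truncated, so the map is
  its own inverse.\<close>

lemma bij_betw_reflect_columns:
  "bij_betw (\<lambda>(x, y). (x, r * x - y)) (sector r) (sector r)"
  by (rule bij_betw_byWitness[where f' = "\<lambda>(x, y). (x, r * x - y)"]) (auto simp: sector_def)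

lemma bij_betw_F: "bij_betw (\<lambda>(x, y). F r (real x, real y)) (sector r) \<nat>"
proof -
  \<comment> \<open>The enumeration takes values in \<open>nat\<close>; \<open>real\<close> carries
    these bijectively onto the set of natural numbers inside the reals.\<close>
  have "bij_betw (real \<circ> (\<lambda>(x, y). column_start r x + y)) (sector r) \<nat>"
    by (rule bij_betw_trans[OF bij_betw_column_enumeration])
      (simp add: bij_betw_def Nats_def inj_on_def)
  then show ?thesis
    by (simp add: F_def real_column_start comp_def case_prod_unfold)
qed

text \<open>The added \<open>r * x\<close> turns \<open>r * x * (x - 1) / 2\<close> into
  \<open>r * x * (x + 1) / 2\<close>.\<close>

lemma G_eq_F_reflect:
  "y \<le> r * x \<Longrightarrow> G r (real x, real y) = F r (real x, real (r * x - y))"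
  by (simp add: F_def G_def of_nat_diff field_simps)

lemma bij_betw_G: "bij_betw (\<lambda>(x, y). G r (real x, real y)) (sector r) \<nat>"
proof -
  have "bij_betw ((\<lambda>(x, y). F r (real x, real y)) \<circ> (\<lambda>(x, y). (x, r * x - y))) (sector r) \<nat>"
    by (rule bij_betw_trans[OF bij_betw_reflect_columns bij_betw_F])
  then show ?thesis
    \<comment> \<open>The two functions are compared on the sector only, where
      \<open>y \<le> r * x\<close> is available.\<close>
    by (rule iffD1[OF bij_betw_cong, rotated]) (auto simp: sector_def G_eq_F_reflect)
qed

lemma real_polynomial_function_fst: "real_polynomial_function (fst :: real \<times> real \<Rightarrow> real)"
  by (rule real_polynomial_function.intros(1)[OF bounded_linear_fst])

lemma real_polynomial_function_snd: "real_polynomial_function (snd :: real \<times> real \<Rightarrow> real)"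
  by (rule real_polynomial_function.intros(1)[OF bounded_linear_snd])

lemmas real_polynomial_function_intros =
  real_polynomial_function.intros(2-4) real_polynomial_function_diff
  real_polynomial_function_divide
  real_polynomial_function_fst real_polynomial_function_snd

lemma real_polynomial_function_F: "real_polynomial_function (F r)"
  unfolding F_def case_prod_unfold by (intro real_polynomial_function_intros)

lemma real_polynomial_function_G: "real_polynomial_function (G r)"
  unfolding G_def case_prod_unfold by (intro real_polynomial_function_intros)

theorem theorem7:
  fixes r :: nat
  assumes "r > 0"
  shows "packing_polynomial (sector r) (F r) \<and> packing_polynomial (sector r) (G r)"
  by (simp add: packing_polynomial_def bij_betw_F bij_betw_G
      real_polynomial_function_F real_polynomial_function_G)

end
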